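(* For any $A,B,B',C,C'\in\widehat{\mathbb{F}_q}$ and any $x,y\in\mathbb{F}_q$, $$F_{2}(A;B,B';C,C';x,y)=\frac{1}{(q-1)^2}\sum_{\chi,\lambda}\binom{A\chi}{\chi}\binom{A\chi\lambda}{\lambda}\binom{B\chi}{C\chi}\binom{B'\lambda}{C'\lambda}\chi(x)\lambda(y)+\overline{A}(-x)\,\overline{C'}(y)\,\overline{B'}C'(1-y)\binom{\overline{A}B}{B\overline{C}},$$ where $\chi$ and $\lambda$ each range over all multiplicative characters of $\mathbb{F}_q$.
   Context: Let $q$ be a power of a prime, $\mathbb{F}_q$ the field with $q$ elements, and $\widehat{\mathbb{F}_q}$ the group of (complex-valued) multiplicative characters of $\mathbb{F}_q^*$. Every character $\chi$, including the trivial character $\varepsilon$, is extended to $\mathbb{F}_q$ by $\chi(0)=0$. $\overline{\chi}$ denotes the inverse of $\chi$. Products of characters are evaluated pointwise, e.g. $\overline{B'}C'(1-y)=\overline{B'}(1-y)C'(1-y)$ and $BC(-1)=B(-1)C(-1)$. Jacobi sum: $J(\chi,\lambda)=\sum_{u\in\mathbb{F}_q}\chi(u)\lambda(1-u)$. Binomial coefficient of characters: $\binom{A}{B}=B(-1)J(A,\overline{B})$. The finite field Appell series $F_2$ is defined, for $A,B,B',C,C'\in\widehat{\mathbb{F}_q}$ and $x,y\in\mathbb{F}_q$, by $$F_{2}(A;B,B';C,C';x,y)=\varepsilon(xy)\,BB'CC'(-1)\sum_{u,v\in\mathbb{F}_q}B(u)B'(v)\,\overline{B}C(1-u)\,\overline{B'}C'(1-v)\,\overline{A}(1-ux-vy).$$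 *)

theory Defs
  imports Complex_Main "HOL-Library.FuncSet" "HOL-Library.Cardinality"
begin

(* The field with q elements is a type 'a :: {field, finite} with q = CARD('a). *)

(* Elements of the character group: homomorphisms from the nonzero elements of 'a to the
   nonzero complex numbers, extended by 0 at 0 (this includes the trivial character). *)
definition mult_chars :: "('a::{field,finite} \<Rightarrow> complex) set" where
  "mult_chars = {\<chi>. \<chi> 0 = 0 \<and> (\<forall>u. u \<noteq> 0 \<longrightarrow> \<chi> u \<noteq> 0)
                 \<and> (\<forall>u v. u \<noteq> 0 \<longrightarrow> v \<noteq> 0 \<longrightarrow> \<chi> (u * v) = \<chi> u * \<chi> v)}"

definition trivial_char :: "'a::{field,finite} \<Rightarrow> complex" where
  "trivial_char u = (if u = 0 then 0 else 1)"

definition char_times :: "('a::{field,finite} \<Rightarrow> complex) \<Rightarrow> ('a \<Rightarrow> complex) \<Rightarrow> 'a \<Rightarrow> complex"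
    (infixl "\<odot>" 70) where
  "(\<chi> \<odot> \<psi>) u = \<chi> u * \<psi> u"

(* The value at 0 is inverse 0 = 0, in accordance with the convention for characters. *)
definition char_inv :: "('a::{field,finite} \<Rightarrow> complex) \<Rightarrow> 'a \<Rightarrow> complex" where
  "char_inv \<chi> u = inverse (\<chi> u)"

definition jacobi_sum :: "('a::{field,finite} \<Rightarrow> complex) \<Rightarrow> ('a \<Rightarrow> complex) \<Rightarrow> complex" where
  "jacobi_sum \<chi> \<psi> = (\<Sum>u\<in>UNIV. \<chi> u * \<psi> (1 - u))"

definition char_binom :: "('a::{field,finite} \<Rightarrow> complex) \<Rightarrow> ('a \<Rightarrow> complex) \<Rightarrow> complex" where
  "char_binom A B = B (-1) * jacobi_sum A (char_inv B)"

definition appell_F2 ::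
  "('a::{field,finite} \<Rightarrow> complex) \<Rightarrow> ('a \<Rightarrow> complex) \<Rightarrow> ('a \<Rightarrow> complex) \<Rightarrow> ('a \<Rightarrow> complex)
    \<Rightarrow> ('a \<Rightarrow> complex) \<Rightarrow> 'a \<Rightarrow> 'a \<Rightarrow> complex" where
  "appell_F2 A B B' C C' x y =
     trivial_char (x * y) * (B \<odot> B' \<odot> C \<odot> C') (-1) *
     (\<Sum>u\<in>UNIV. \<Sum>v\<in>UNIV. B u * B' v * (char_inv B \<odot> C) (1 - u) * (char_inv B' \<odot> C') (1 - v)
        * char_inv A (1 - u * x - v * y))"

lemma mult_chars_one:
  assumes "\<chi> \<in> mult_chars"
  shows "\<chi> 1 = 1"
proof -
  have "\<chi> 1 \<noteq> 0" "\<chi> (1 * 1) = \<chi> 1 * \<chi> 1"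
    using assms unfolding mult_chars_def by (auto simp del: mult_1 mult_1_right)
  then show ?thesis by simp
qed

lemma mult_chars_mult: "\<chi> \<in> mult_chars \<Longrightarrow> \<chi> (u * v) = \<chi> u * \<chi> v"
  by (cases "u = 0"; cases "v = 0") (auto simp: mult_chars_def)

lemma trivial_char_in: "trivial_char \<in> mult_chars"
  by (auto simp: mult_chars_def trivial_char_def)

lemma char_times_in: "\<chi> \<in> mult_chars \<Longrightarrow> \<psi> \<in> mult_chars \<Longrightarrow> \<chi> \<odot> \<psi> \<in> mult_chars"
  by (auto simp: mult_chars_def char_times_def)

lemma char_inv_in: "\<chi> \<in> mult_chars \<Longrightarrow> char_inv \<chi> \<in> mult_chars"
  by (auto simp: mult_chars_def char_inv_def)

lemma trivial_char_times: "\<chi> \<in> mult_chars \<Longrightarrow> trivial_char \<odot> \<chi> = \<chi>"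
  by (auto simp: fun_eq_iff mult_chars_def char_times_def trivial_char_def)

lemma char_inv_times: "\<chi> \<in> mult_chars \<Longrightarrow> char_inv \<chi> \<odot> \<chi> = trivial_char"
  by (auto simp: fun_eq_iff mult_chars_def char_times_def char_inv_def trivial_char_def)

lemma ex_power_eq_one:
  fixes u :: "'a::{field,finite}"
  assumes "u \<noteq> 0"
  shows "\<exists>n>0. u ^ n = 1"
proof -
  have "\<not> inj (\<lambda>n::nat. u ^ n)"
    using finite_imageD[of "\<lambda>n. u ^ n" "UNIV :: nat set"] by auto
  then obtain m n where mn: "m < n" "u ^ m = u ^ n"
    unfolding inj_on_def by (metis linorder_neqE_nat)
  have "u ^ n = u ^ m * u ^ (n - m)"
    using mn(1) by (metis le_add_diff_inverse less_imp_le power_add)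
  then have "u ^ (n - m) = 1"
    using assms mn(2) by simp
  then show ?thesis
    using mn(1) by (intro exI[of _ "n - m"]) simp
qed

lemma finite_mult_chars: "finite (mult_chars :: ('a::{field,finite} \<Rightarrow> complex) set)"
proof -
  obtain n :: "'a \<Rightarrow> nat" where n: "n u > 0 \<and> u ^ n u = 1" if "u \<noteq> 0" for u
    using ex_power_eq_one by metis
  define S where "S u = (if u = 0 then {0} else {z::complex. z ^ n u = 1})" for u
  have pow: "\<chi> (u ^ k) = \<chi> u ^ k" if "\<chi> \<in> mult_chars" for \<chi> and u :: 'a and k
    using that by (induction k) (auto simp: mult_chars_one mult_chars_mult)
  have "(mult_chars :: ('a \<Rightarrow> complex) set) \<subseteq> PiE UNIV S"
  proof
    fix \<chi> :: "'a \<Rightarrow> complex" assume *: "\<chi> \<in> mult_chars"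
    have "\<chi> u \<in> S u" for u
    proof (cases "u = 0")
      case True
      then show ?thesis using * by (simp add: S_def mult_chars_def)
    next
      case False
      then show ?thesis
        using n[of u] pow[OF *, of u "n u"] mult_chars_one[OF *] by (simp add: S_def)
    qed
    then show "\<chi> \<in> PiE UNIV S" by auto
  qed
  moreover have "finite (PiE UNIV S)"
  proof (rule finite_PiE)
    fix u :: 'a
    show "finite (S u)"
      using n[of u] finite_roots_unity[of "n u", where 'a = complex] by (auto simp: S_def)
  qed simp
  ultimately show ?thesis by (rule finite_subset)
qed

end

theory Submission
  imports Defs "HOL-Algebra.Multiplicative_Group" "HOL-Algebra.Algebraic_Closure_Type"
begin

no_notation Module.smult (infixl "\<odot>\<index>" 70)

text \<open>
  After the substitution $u \mapsto u/(u-1)$, the binomials $\binom{B\chi}{C\chi}$ and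
  $\binom{B'\lambda}{C'\lambda}$ become the sums over $u$ and $v$ that occur in $F_2$. By
  orthogonality of characters, $\sum_\lambda \binom{A\lambda}{\lambda}\lambda(b) =
  (q-1)\overline{A}(1-b)$ for $b \neq 0$. Applying this to $\lambda$ with $b = vy$ and then to
  $\chi$ with argument $ux/(1-vy)$ produces $\overline{A}(1-ux-vy)$, but only if $vy \neq 1$.
  The terms of $F_2$ with $v = 1/y$ are therefore missing from the double character sum, and
  they form the extra summand.
\<close>

section \<open>Cyclicity of the multiplicative group and separation of points by characters\<close>

text \<open>The multiplicative group of a finite field is cyclic. This is known for fields given as
  records, so it is carried over along \<open>ring_of_type_algebra\<close>, whose carrier is all of
  \<open>UNIV\<close>.\<close>

lemma ex_mult_generator:
  "\<exists>g::'a::{Fields.field,finite}. g \<noteq> 0 \<and> (\<forall>u. u \<noteq> 0 \<longrightarrow> (\<exists>k. u = g ^ k))"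
proof -
  define K where "K = (ring_of_type_algebra :: 'a ring)"
  interpret K: Ring.field K
    unfolding K_def by (rule field_from_type_algebra)
  have car: "carrier K = UNIV" "\<zero>\<^bsub>K\<^esub> = 0"
    by (simp_all add: K_def ring_of_type_algebra_def)
  have pow: "u [^]\<^bsub>K\<^esub> k = u ^ k" for u :: 'a and k :: nat
    by (induction k) (simp_all add: K_def ring_of_type_algebra_def mult.commute)
  obtain g where "g \<in> carrier (mult_of K)"
      "carrier (mult_of K) = {g [^]\<^bsub>K\<^esub> i | i::nat. i \<in> UNIV}"
    using K.finite_field_mult_group_has_gen by (auto simp: car)
  then have "g \<noteq> 0" "UNIV - {0} = {g ^ i | i::nat. True}"
    by (auto simp: car pow)
  then show ?thesis by blast
qed

text \<open>Sending a generator \<open>g\<close> of order \<open>n\<close> to the primitive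
  \<open>n\<close>-th root of unity \<open>w\<close> defines a character that takes the value 1 only
  at 1, so this one character serves for every \<open>a\<close>.\<close>

lemma mult_chars_separate:
  fixes a :: "'a::{Fields.field,finite}"
  assumes "a \<noteq> 0" "a \<noteq> 1"
  shows "\<exists>\<chi>\<in>mult_chars. \<chi> a \<noteq> 1"
proof -
  obtain g :: 'a where g0: "g \<noteq> 0" and g: "\<And>u. u \<noteq> 0 \<Longrightarrow> \<exists>k. u = g ^ k"
    using ex_mult_generator by blast
  define n where "n = (LEAST n. n > 0 \<and> g ^ n = 1)"
  have n: "n > 0" "g ^ n = 1"
    using LeastI_ex[OF ex_power_eq_one[OF g0]] by (simp_all add: n_def)
  have n_le: "n \<le> m" if "m > 0" "g ^ m = 1" for m
    unfolding n_def using that by (simp add: Least_le)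
  \<comment> \<open>Stated for any monoid because it serves both \<open>g\<close> in the field and
    \<open>w\<close> in the complex numbers.\<close>
  have pow_mod: "z ^ k = z ^ (k mod n)" if "z ^ n = 1" for z :: "'b::monoid_mult" and k
  proof -
    have "z ^ k = z ^ (n * (k div n) + k mod n)" by simp
    also have "\<dots> = z ^ (k mod n)" by (simp only: power_add power_mult that) simp
    finally show ?thesis .
  qed
  have g_dvd: "n dvd m" if "g ^ m = 1" for m
    using n_le[of "m mod n"] pow_mod[OF n(2), of m] that n(1) mod_less_divisor[of n m]
    by (metis dvd_eq_mod_eq_0 gr0I not_le)
  define w where "w = cis (2 * pi / n)"
  have w_pow: "w ^ k = cis (2 * pi * real k / real n)" for k
    by (simp add: w_def DeMoivre mult_ac)
  have wn: "w ^ n = 1" using n(1) by (simp add: w_pow)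
  \<comment> \<open>\<open>w\<close> has exact order \<open>n\<close>: its powers with exponents
    below \<open>n\<close> are pairwise distinct, being the \<open>n\<close> roots of unity.\<close>
  have w_dvd: "n dvd k" if "w ^ k = 1" for k
  proof -
    have "w ^ (k mod n) = w ^ 0" using that pow_mod[OF wn, of k] by simp
    then have "k mod n = 0"
      using bij_betw_roots_unity[OF n(1)] n(1)
      unfolding bij_betw_def inj_on_def w_pow by auto
    then show ?thesis by auto
  qed
  \<comment> \<open>The discrete logarithm below is an arbitrary choice of exponent; this makes the
    resulting power of \<open>w\<close> independent of that choice.\<close>
  have w_cong: "w ^ i = w ^ j" if "g ^ i = g ^ j" for i j
  proof -
    have *: "w ^ i = w ^ j" if "g ^ i = g ^ j" "i \<le> j" for i j
    proof -
      have "g ^ j = g ^ i * g ^ (j - i)" using that(2) by (simp flip: power_add)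
      then have "g ^ (j - i) = 1" using that g0 by simp
      then have "n dvd j - i" by (rule g_dvd)
      then have "w ^ (j - i) = 1" using wn by (auto simp: power_mult)
      moreover have "w ^ j = w ^ i * w ^ (j - i)" using that(2) by (simp flip: power_add)
      ultimately show ?thesis by simp
    qed
    show ?thesis
      using *[OF that] *[OF that[symmetric], symmetric] nat_le_linear[of i j] by blast
  qed
  define dlog where "dlog u = (SOME k. u = g ^ k)" for u
  have dlog: "u = g ^ dlog u" if "u \<noteq> 0" for u
    unfolding dlog_def using g[OF that] by (rule someI_ex)
  define \<chi> where "\<chi> u = (if u = 0 then 0 else w ^ dlog u)" for u
  have w0: "w \<noteq> 0" by (simp add: w_def)
  have "w ^ dlog (u * v) = w ^ dlog u * w ^ dlog v" if "u \<noteq> 0" "v \<noteq> 0" for u v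
  proof -
    have "g ^ dlog (u * v) = g ^ (dlog u + dlog v)"
      using dlog[of u, symmetric] dlog[of v, symmetric] dlog[of "u * v", symmetric] that
      by (simp add: power_add)
    then show ?thesis using w_cong power_add by metis
  qed
  then have "\<chi> \<in> mult_chars"
    using w0 by (auto simp: mult_chars_def \<chi>_def)
  moreover have "\<chi> a \<noteq> 1"
  proof
    assume "\<chi> a = 1"
    then have "n dvd dlog a" using assms by (intro w_dvd) (simp add: \<chi>_def)
    then have "g ^ dlog a = 1" using n(2) by (auto simp: power_mult)
    then show False using dlog[of a] assms by simp
  qed
  ultimately show ?thesis by blast
qed

section \<open>Characters at inverses, quotients and negatives\<close>

lemma mult_chars_zero: "\<chi> \<in> mult_chars \<Longrightarrow> \<chi> 0 = 0"
  by (simp add: mult_chars_def)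

lemma mult_chars_nonzero: "\<chi> \<in> mult_chars \<Longrightarrow> u \<noteq> 0 \<Longrightarrow> \<chi> u \<noteq> 0"
  by (simp add: mult_chars_def)

text \<open>The case \<open>u = 0\<close> is covered by \<open>inverse 0 = 0\<close> in both fields,
  so that quotients in arguments of characters need no side condition.\<close>

lemma mult_chars_inverse: "\<chi> \<in> mult_chars \<Longrightarrow> \<chi> (inverse u) = inverse (\<chi> u)"
  by (cases "u = 0")
     (auto simp: mult_chars_zero mult_chars_nonzero mult_chars_one field_simps
           simp flip: mult_chars_mult)

lemma mult_chars_divide: "\<chi> \<in> mult_chars \<Longrightarrow> \<chi> (u / v) = \<chi> u / \<chi> v"
  by (simp add: divide_inverse mult_chars_mult mult_chars_inverse)

lemma mult_chars_minus: "\<chi> \<in> mult_chars \<Longrightarrow> \<chi> (- u) = \<chi> (-1) * \<chi> u"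
  by (simp flip: mult_chars_mult)

lemma mult_chars_minus_one_square: "\<chi> \<in> mult_chars \<Longrightarrow> \<chi> (-1) * \<chi> (-1) = 1"
  by (simp add: mult_chars_one flip: mult_chars_mult)

section \<open>Orthogonality relations\<close>

text \<open>Replacing \<open>u\<close> by \<open>a * u\<close> permutes the field and multiplies the
  sum by \<open>\<chi> a\<close>; some nonzero \<open>a\<close> makes this factor different from
  1.\<close>

lemma sum_mult_char:
  fixes \<chi> :: "'a::{Fields.field,finite} \<Rightarrow> complex"
  assumes "\<chi> \<in> mult_chars" "\<chi> \<noteq> trivial_char"
  shows "(\<Sum>u\<in>UNIV. \<chi> u) = 0"
proof -
  obtain a where a: "\<chi> a \<noteq> trivial_char a" using assms(2) by auto
  then have a0: "a \<noteq> 0" and a1: "\<chi> a \<noteq> 1"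
    using assms(1) by (auto simp: trivial_char_def mult_chars_zero split: if_splits)
  have "(\<Sum>u\<in>UNIV. \<chi> u) = (\<Sum>u\<in>UNIV. \<chi> (a * u))"
    by (rule sum.reindex_bij_witness[of _ "\<lambda>u. a * u" "\<lambda>u. u / a"]) (use a0 in auto)
  also have "\<dots> = \<chi> a * (\<Sum>u\<in>UNIV. \<chi> u)"
    by (simp add: mult_chars_mult assms(1) sum_distrib_left)
  finally show ?thesis using a1 by simp
qed

lemma sum_trivial_char:
  "(\<Sum>u\<in>(UNIV :: 'a::{Fields.field,finite} set). trivial_char u) = of_nat CARD('a) - 1"
proof -
  have "(\<Sum>u\<in>(UNIV :: 'a set). trivial_char u) = (\<Sum>u\<in>(UNIV :: 'a set). 1 - (if u = 0 then 1 else 0))"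
    by (rule sum.cong) (auto simp: trivial_char_def)
  also have "\<dots> = of_nat CARD('a) - 1" by (simp add: sum_subtractf)
  finally show ?thesis .
qed

text \<open>Dual argument: multiplication by a character \<open>\<psi>\<close> with
  \<open>\<psi> a\<close> different from 1 permutes the characters and multiplies the sum by
  \<open>\<psi> a\<close>. At \<open>a = 0\<close> every term vanishes.\<close>

lemma sum_mult_chars_at_not_one:
  fixes a :: "'a::{Fields.field,finite}"
  assumes "a \<noteq> 1"
  shows "(\<Sum>\<chi>\<in>mult_chars. \<chi> a) = 0"
proof (cases "a = 0")
  case False
  then obtain \<psi> :: "'a \<Rightarrow> complex" where \<psi>: "\<psi> \<in> mult_chars" "\<psi> a \<noteq> 1"
    using mult_chars_separate assms by blast
  \<comment> \<open>\<open>\<psi>\<close> and its inverse multiply to the trivial character, which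
    is 0 at 0; it acts as identity because \<open>\<chi>\<close> vanishes there too.\<close>
  have cancel: "\<psi> \<odot> (char_inv \<psi> \<odot> \<chi>) = \<chi>" "char_inv \<psi> \<odot> (\<psi> \<odot> \<chi>) = \<chi>"
    if "\<chi> \<in> mult_chars" for \<chi>
  proof -
    have "\<psi> u * (inverse (\<psi> u) * \<chi> u) = \<chi> u \<and> inverse (\<psi> u) * (\<psi> u * \<chi> u) = \<chi> u" for u
      using mult_chars_nonzero[OF \<psi>(1), of u] mult_chars_zero[OF that] by (cases "u = 0") auto
    then show "\<psi> \<odot> (char_inv \<psi> \<odot> \<chi>) = \<chi>" "char_inv \<psi> \<odot> (\<psi> \<odot> \<chi>) = \<chi>"
      by (auto simp: fun_eq_iff char_times_def char_inv_def)
  qed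
  have "(\<Sum>\<chi>\<in>mult_chars. \<chi> a) = (\<Sum>\<chi>\<in>mult_chars. (\<psi> \<odot> \<chi>) a)"
    by (rule sum.reindex_bij_witness[of _ "\<lambda>\<chi>. \<psi> \<odot> \<chi>" "\<lambda>\<chi>. char_inv \<psi> \<odot> \<chi>"])
       (use \<psi>(1) cancel in \<open>auto intro: char_times_in char_inv_in\<close>)
  also have "\<dots> = \<psi> a * (\<Sum>\<chi>\<in>mult_chars. \<chi> a)"
    by (simp add: char_times_def sum_distrib_left)
  finally show ?thesis using \<psi>(2) by simp
qed (simp add: mult_chars_zero)

text \<open>Counts the characters by summing all values \<open>\<chi> a\<close> in two ways: summing
  over characters first leaves only \<open>a = 1\<close>, summing over the field first leaves only
  the trivial character.\<close>

lemma sum_mult_chars_at_one: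
  "(\<Sum>\<chi>\<in>mult_chars. \<chi> (1 :: 'a::{Fields.field,finite})) = of_nat CARD('a) - 1"
proof -
  have "(\<Sum>\<chi>\<in>mult_chars. \<chi> (1::'a)) = (\<Sum>a\<in>UNIV. \<Sum>\<chi>\<in>mult_chars. \<chi> (a::'a))"
    by (subst sum.remove[of _ 1]) (simp_all add: sum_mult_chars_at_not_one)
  also have "\<dots> = (\<Sum>\<chi>\<in>mult_chars. \<Sum>a\<in>UNIV. \<chi> (a::'a))"
    by (rule sum.swap)
  also have "\<dots> = of_nat CARD('a) - 1"
    by (subst sum.remove[of _ trivial_char])
       (simp_all add: finite_mult_chars trivial_char_in sum_mult_char sum_trivial_char)
  finally show ?thesis .
qed

lemma sum_mult_chars:
  fixes a :: "'a::{Fields.field,finite}"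
  shows "(\<Sum>\<chi>\<in>mult_chars. \<chi> a) = (if a = 1 then of_nat CARD('a) - 1 else 0)"
proof (cases "a = 1")
  case True
  then show ?thesis by (simp only: sum_mult_chars_at_one refl if_True)
next
  case False
  then show ?thesis by (simp only: sum_mult_chars_at_not_one[OF False] if_False)
qed

section \<open>Character sums of binomials\<close>

text \<open>After expanding the Jacobi sum over \<open>w\<close>, orthogonality keeps only the
  solution of \<open>- (w * b) / (1 - w) = 1\<close>, namely
  \<open>w = inverse (1 - b)\<close>.\<close>

lemma sum_char_binom:
  fixes b :: "'a::{Fields.field,finite}"
  assumes A: "A \<in> mult_chars" and b: "b \<noteq> 0"
  shows "(\<Sum>\<psi>\<in>mult_chars. char_binom (A \<odot> \<psi>) \<psi> * \<psi> b)
    = (of_nat CARD('a) - 1) * char_inv A (1 - b)"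
proof -
  have "(\<Sum>\<psi>\<in>mult_chars. char_binom (A \<odot> \<psi>) \<psi> * \<psi> b)
      = (\<Sum>\<psi>\<in>mult_chars. \<Sum>w\<in>UNIV. A w * \<psi> (- (w * b) / (1 - w)))"
  proof (rule sum.cong[OF refl])
    fix \<psi> :: "'a \<Rightarrow> complex" assume \<psi>: "\<psi> \<in> mult_chars"
    have "\<psi> (- (w * b) / (1 - w)) = \<psi> (-1) * \<psi> w * \<psi> b * inverse (\<psi> (1 - w))" for w
      unfolding mult_chars_divide[OF \<psi>] mult_chars_minus[OF \<psi>, of "w * b"]
        mult_chars_mult[OF \<psi>, of w b] by (simp add: divide_inverse)
    then show "char_binom (A \<odot> \<psi>) \<psi> * \<psi> b = (\<Sum>w\<in>UNIV. A w * \<psi> (- (w * b) / (1 - w)))"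
      by (simp add: char_binom_def jacobi_sum_def char_times_def char_inv_def sum_distrib_left
          sum_distrib_right mult_ac)
  qed
  also have "\<dots> = (\<Sum>w\<in>UNIV. A w * (\<Sum>\<psi>\<in>mult_chars. \<psi> (- (w * b) / (1 - w))))"
    by (subst sum.swap) (simp add: sum_distrib_left)
  also have "\<dots> = (\<Sum>w\<in>UNIV. if w = inverse (1 - b) then A w * (of_nat CARD('a) - 1) else 0)"
  proof (rule sum.cong[OF refl])
    fix w :: 'a
    \<comment> \<open>If \<open>w = 1\<close> or \<open>b = 1\<close>, both sides are false: a
      quotient by 0 is 0, and \<open>inverse 0 = 0\<close> differs from \<open>w\<close>.\<close>
    have "- (w * b) / (1 - w) = 1 \<longleftrightarrow> w = inverse (1 - b)" if "w \<noteq> 0"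
    proof (cases "w = 1 \<or> b = 1")
      case True
      then show ?thesis using b that by (auto simp: divide_simps)
    next
      case False
      then show ?thesis by (auto simp: divide_simps algebra_simps)
    qed
    moreover have "A 0 = 0" using A by (rule mult_chars_zero)
    ultimately show "A w * (\<Sum>\<psi>\<in>mult_chars. \<psi> (- (w * b) / (1 - w)))
      = (if w = inverse (1 - b) then A w * (of_nat CARD('a) - 1) else 0)"
      unfolding sum_mult_chars by (cases "w = 0") auto
  qed
  also have "\<dots> = (of_nat CARD('a) - 1) * char_inv A (1 - b)"
    by (simp add: char_inv_def mult_chars_inverse[OF A])
  finally show ?thesis .
qed

text \<open>The case \<open>b = 1\<close> is a true exception: the inner sum then contains an
  inverse character at 0 and vanishes, whereas \<open>char_inv A (- a)\<close> is nonzero.\<close>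

lemma sum_sum_char_binom:
  fixes a b :: "'a::{Fields.field,finite}"
  assumes A: "A \<in> mult_chars" and a: "a \<noteq> 0" and b: "b \<noteq> 0"
  shows "(\<Sum>\<chi>\<in>mult_chars. \<Sum>\<psi>\<in>mult_chars.
      char_binom (A \<odot> \<chi>) \<chi> * char_binom (A \<odot> \<chi> \<odot> \<psi>) \<psi> * \<chi> a * \<psi> b)
    = (of_nat CARD('a) - 1) ^ 2 * (if b = 1 then 0 else char_inv A (1 - a - b))"
proof -
  let ?q = "of_nat CARD('a) - 1 :: complex"
  have "(\<Sum>\<chi>\<in>mult_chars. \<Sum>\<psi>\<in>mult_chars.
      char_binom (A \<odot> \<chi>) \<chi> * char_binom (A \<odot> \<chi> \<odot> \<psi>) \<psi> * \<chi> a * \<psi> b)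
    = (\<Sum>\<chi>\<in>mult_chars. char_binom (A \<odot> \<chi>) \<chi> * \<chi> a *
        (\<Sum>\<psi>\<in>mult_chars. char_binom (A \<odot> \<chi> \<odot> \<psi>) \<psi> * \<psi> b))"
    by (simp add: sum_distrib_left mult_ac)
  also have "\<dots> = (\<Sum>\<chi>\<in>mult_chars.
      ?q * char_inv A (1 - b) * (char_binom (A \<odot> \<chi>) \<chi> * \<chi> (a / (1 - b))))"
  proof (rule sum.cong[OF refl])
    fix \<chi> :: "'a \<Rightarrow> complex" assume \<chi>: "\<chi> \<in> mult_chars"
    show "char_binom (A \<odot> \<chi>) \<chi> * \<chi> a *
        (\<Sum>\<psi>\<in>mult_chars. char_binom (A \<odot> \<chi> \<odot> \<psi>) \<psi> * \<psi> b)
      = ?q * char_inv A (1 - b) * (char_binom (A \<odot> \<chi>) \<chi> * \<chi> (a / (1 - b)))"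
      \<comment> \<open>The inner sum, taken for \<open>A \<odot> \<chi>\<close>, contributes the
        inverse of \<open>\<chi> (1 - b)\<close>, which is absorbed into the argument of
        \<open>\<chi>\<close>.\<close>
      unfolding sum_char_binom[OF char_times_in[OF A \<chi>] b] mult_chars_divide[OF \<chi>]
      by (simp add: char_inv_def char_times_def divide_inverse)
  qed
  also have "\<dots> = ?q * char_inv A (1 - b) *
      (\<Sum>\<chi>\<in>mult_chars. char_binom (A \<odot> \<chi>) \<chi> * \<chi> (a / (1 - b)))"
    by (simp add: sum_distrib_left)
  also have "\<dots> = ?q ^ 2 * (if b = 1 then 0 else char_inv A (1 - a - b))"
  proof (cases "b = 1")
    case True
    then show ?thesis by (simp add: char_inv_def mult_chars_zero[OF A])
  next
    case False
    then have "(1 - b) * (1 - a / (1 - b)) = 1 - a - b"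
      by (simp add: field_simps)
    then have "char_inv A (1 - b) * char_inv A (1 - a / (1 - b)) = char_inv A (1 - a - b)"
      by (simp flip: mult_chars_mult[OF char_inv_in[OF A]])
    with False a show ?thesis
      by (simp add: sum_char_binom[OF A] power2_eq_square mult_ac)
  qed
  finally show ?thesis .
qed

section \<open>Binomials with a common twist as sums over the field\<close>

text \<open>The substitution by \<open>- u / (1 - u)\<close> moves the whole twist into the single
  factor \<open>\<chi> u\<close>, the form needed to merge it with \<open>\<chi> x\<close>.\<close>

lemma char_binom_times_common:
  fixes B C \<chi> :: "'a::{Fields.field,finite} \<Rightarrow> complex"
  assumes B: "B \<in> mult_chars" and C: "C \<in> mult_chars" and \<chi>: "\<chi> \<in> mult_chars"
  shows "char_binom (B \<odot> \<chi>) (C \<odot> \<chi>)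
    = (B \<odot> C) (-1) * (\<Sum>u\<in>UNIV. B u * (char_inv B \<odot> C) (1 - u) * \<chi> u)"
proof -
  define f where "f u = B u * \<chi> u * inverse (C (1 - u) * \<chi> (1 - u))" for u
  define h where "h u = B u * (char_inv B \<odot> C) (1 - u) * \<chi> u" for u
  note zero = mult_chars_zero[OF B] mult_chars_zero[OF C] mult_chars_zero[OF \<chi>]
  have "(\<Sum>u\<in>UNIV. f u) = (\<Sum>u\<in>UNIV - {1}. f u)"
    \<comment> \<open>The term at the pole \<open>u = 1\<close> of the substitution vanishes, since
      \<open>C 0 = 0\<close> and \<open>inverse 0 = 0\<close>.\<close>
    by (rule sum.mono_neutral_right) (auto simp: f_def zero)
  also have "\<dots> = (\<Sum>u\<in>UNIV - {1}. B (-1) * \<chi> (-1) * h u)"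
  proof (rule sum.reindex_bij_witness[of _ "\<lambda>u. - u / (1 - u)" "\<lambda>u. - u / (1 - u)"])
    fix u :: 'a assume "u \<in> UNIV - {1}"
    then have u: "1 - u \<noteq> 0" by auto
    \<comment> \<open>The substitution is an involution off 1 and inverts \<open>1 - u\<close>, so
      the factors \<open>B (1 - u)\<close> cancel below.\<close>
    have u': "1 - - u / (1 - u) = inverse (1 - u)" using u by (simp add: field_simps)
    have uu: "- (- u / (1 - u)) / (1 - - u / (1 - u)) = u"
      unfolding u' using u by simp
    show "- (- u / (1 - u)) / (1 - - u / (1 - u)) = u" by (rule uu)
    show "- (- u / (1 - u)) / (1 - - u / (1 - u)) = u" by (rule uu)
    have "1 - - u / (1 - u) \<noteq> 0" unfolding u' using u by simp
    then have "- u / (1 - u) \<noteq> 1" by (metis diff_self)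
    then have mem: "- u / (1 - u) \<in> UNIV - {1}" by simp
    show "- u / (1 - u) \<in> UNIV - {1}" by (rule mem)
    show "- u / (1 - u) \<in> UNIV - {1}" by (rule mem)
    have val: "\<psi> (- u / (1 - u)) = \<psi> (-1) * \<psi> u * inverse (\<psi> (1 - u))"
      if "\<psi> \<in> mult_chars" for \<psi> :: "'a \<Rightarrow> complex"
      unfolding mult_chars_divide[OF that] mult_chars_minus[OF that, of u]
      by (simp add: divide_inverse)
    have "B (-1) * \<chi> (-1) * h (- u / (1 - u))
        = (B (-1) * B (-1)) * (\<chi> (-1) * \<chi> (-1)) * (B (1 - u) * inverse (B (1 - u))) * f u"
      unfolding f_def h_def u' char_times_def char_inv_def val[OF B] val[OF \<chi>]
        mult_chars_inverse[OF B] mult_chars_inverse[OF C]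
      by (simp only: inverse_inverse_eq inverse_mult_distrib mult_ac)
    then show "B (-1) * \<chi> (-1) * h (- u / (1 - u)) = f u"
      using mult_chars_nonzero[OF B u]
      by (simp add: mult_chars_minus_one_square[OF B] mult_chars_minus_one_square[OF \<chi>])
  qed
  also have "\<dots> = (\<Sum>u\<in>UNIV. B (-1) * \<chi> (-1) * h u)"
    by (rule sum.mono_neutral_left) (auto simp: h_def zero char_times_def)
  finally have "(\<Sum>u\<in>UNIV. f u) = B (-1) * \<chi> (-1) * (\<Sum>u\<in>UNIV. h u)"
    by (simp add: sum_distrib_left)
  moreover have "char_binom (B \<odot> \<chi>) (C \<odot> \<chi>) = C (-1) * \<chi> (-1) * (\<Sum>u\<in>UNIV. f u)"
    by (simp add: char_binom_def jacobi_sum_def f_def char_times_def char_inv_def)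
  \<comment> \<open>One sign \<open>\<chi> (-1)\<close> comes from the binomial and one from the
    substitution; together they give 1.\<close>
  moreover have "(B \<odot> C) (-1) = B (-1) * C (-1) * (\<chi> (-1) * \<chi> (-1))"
    by (simp add: char_times_def mult_chars_minus_one_square[OF \<chi>])
  ultimately show ?thesis by (simp add: h_def mult_ac)
qed

lemma of_nat_card_minus_one_nonzero:
  "(of_nat CARD('a::{Fields.field,finite}) - 1 :: complex) \<noteq> 0"
proof -
  have "card {0, 1 :: 'a} \<le> CARD('a)" by (rule card_mono) auto
  then have "CARD('a) \<noteq> 1" by simp
  then show ?thesis by (metis eq_iff_diff_eq_0 of_nat_1 of_nat_eq_iff)
qed

lemma sum_swap_pairs:
  "(\<Sum>a\<in>A. \<Sum>b\<in>B. \<Sum>c\<in>C. \<Sum>d\<in>D. f a b c d)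
    = (\<Sum>c\<in>C. \<Sum>d\<in>D. \<Sum>a\<in>A. \<Sum>b\<in>B. f a b c d)"
proof -
  have "(\<Sum>a\<in>A. \<Sum>b\<in>B. \<Sum>c\<in>C. \<Sum>d\<in>D. f a b c d)
      = (\<Sum>a\<in>A. \<Sum>c\<in>C. \<Sum>b\<in>B. \<Sum>d\<in>D. f a b c d)"
    by (rule sum.cong[OF refl], rule sum.swap)
  also have "\<dots> = (\<Sum>c\<in>C. \<Sum>a\<in>A. \<Sum>b\<in>B. \<Sum>d\<in>D. f a b c d)"
    by (rule sum.swap)
  also have "\<dots> = (\<Sum>c\<in>C. \<Sum>a\<in>A. \<Sum>d\<in>D. \<Sum>b\<in>B. f a b c d)"
    by (rule sum.cong[OF refl], rule sum.cong[OF refl], rule sum.swap)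
  also have "\<dots> = (\<Sum>c\<in>C. \<Sum>d\<in>D. \<Sum>a\<in>A. \<Sum>b\<in>B. f a b c d)"
    by (rule sum.cong[OF refl], rule sum.swap)
  finally show ?thesis .
qed

section \<open>Splitting the Appell series along \<open>v * y = 1\<close>\<close>

text \<open>Expanding only the two binomials without \<open>A\<close> and interchanging sums leaves
  \<open>sum_sum_char_binom\<close> at \<open>u * x\<close> and \<open>v * y\<close>, whose
  exceptional case becomes the excluded terms.\<close>

lemma appell_character_sum:
  fixes A B B' C C' :: "'a::{Fields.field,finite} \<Rightarrow> complex" and x y :: 'a
  assumes A: "A \<in> mult_chars" and B: "B \<in> mult_chars" and B': "B' \<in> mult_chars"
    and C: "C \<in> mult_chars" and C': "C' \<in> mult_chars"
    and x: "x \<noteq> 0" and y: "y \<noteq> 0"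
  shows "(\<Sum>\<chi>\<in>mult_chars. \<Sum>\<psi>\<in>mult_chars.
         char_binom (A \<odot> \<chi>) \<chi> * char_binom (A \<odot> \<chi> \<odot> \<psi>) \<psi>
         * char_binom (B \<odot> \<chi>) (C \<odot> \<chi>) * char_binom (B' \<odot> \<psi>) (C' \<odot> \<psi>)
         * \<chi> x * \<psi> y)
    = (of_nat CARD('a) - 1) ^ 2 * (B \<odot> B' \<odot> C \<odot> C') (-1) *
     (\<Sum>u\<in>UNIV. \<Sum>v\<in>UNIV. B u * B' v * (char_inv B \<odot> C) (1 - u) * (char_inv B' \<odot> C') (1 - v)
        * (if v * y = 1 then 0 else char_inv A (1 - u * x - v * y)))"
proof -
  let ?e = "(B \<odot> B' \<odot> C \<odot> C') (-1)"
  let ?q = "of_nat CARD('a) - 1 :: complex"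
  define f where "f u = B u * (char_inv B \<odot> C) (1 - u)" for u
  define g where "g v = B' v * (char_inv B' \<odot> C') (1 - v)" for v
  define G where "G \<chi> \<psi> = char_binom (A \<odot> \<chi>) \<chi> * char_binom (A \<odot> \<chi> \<odot> \<psi>) \<psi>" for \<chi> \<psi>
  have "(\<Sum>\<chi>\<in>mult_chars. \<Sum>\<psi>\<in>mult_chars. G \<chi> \<psi>
         * char_binom (B \<odot> \<chi>) (C \<odot> \<chi>) * char_binom (B' \<odot> \<psi>) (C' \<odot> \<psi>) * \<chi> x * \<psi> y)
    = (\<Sum>\<chi>\<in>mult_chars. \<Sum>\<psi>\<in>mult_chars. \<Sum>u\<in>UNIV. \<Sum>v\<in>UNIV.
         ?e * (f u * g v) * (G \<chi> \<psi> * \<chi> (u * x) * \<psi> (v * y)))"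
  proof (intro sum.cong refl)
    fix \<chi> \<psi> :: "'a \<Rightarrow> complex" assume \<chi>: "\<chi> \<in> mult_chars" and \<psi>: "\<psi> \<in> mult_chars"
    show "G \<chi> \<psi> * char_binom (B \<odot> \<chi>) (C \<odot> \<chi>) * char_binom (B' \<odot> \<psi>) (C' \<odot> \<psi>) * \<chi> x * \<psi> y
      = (\<Sum>u\<in>UNIV. \<Sum>v\<in>UNIV. ?e * (f u * g v) * (G \<chi> \<psi> * \<chi> (u * x) * \<psi> (v * y)))"
      unfolding char_binom_times_common[OF B C \<chi>] char_binom_times_common[OF B' C' \<psi>]
        f_def[symmetric] g_def[symmetric] mult_chars_mult[OF \<chi>] mult_chars_mult[OF \<psi>]
        char_times_def[of _ _ "-1"]
      by (simp add: sum_distrib_left sum_distrib_right mult_ac)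
  qed
  also have "\<dots> = (\<Sum>u\<in>UNIV. \<Sum>v\<in>UNIV. \<Sum>\<chi>\<in>mult_chars. \<Sum>\<psi>\<in>mult_chars.
         ?e * (f u * g v) * (G \<chi> \<psi> * \<chi> (u * x) * \<psi> (v * y)))"
    by (rule sum_swap_pairs)
  also have "\<dots> = (\<Sum>u\<in>UNIV. \<Sum>v\<in>UNIV. ?e * (f u * g v) *
      (\<Sum>\<chi>\<in>mult_chars. \<Sum>\<psi>\<in>mult_chars. G \<chi> \<psi> * \<chi> (u * x) * \<psi> (v * y)))"
    by (simp add: sum_distrib_left)
  also have "\<dots> = (\<Sum>u\<in>UNIV. \<Sum>v\<in>UNIV. ?e * (f u * g v) *
      (?q ^ 2 * (if v * y = 1 then 0 else char_inv A (1 - u * x - v * y))))"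
  proof (intro sum.cong refl)
    fix u v :: 'a
    show "?e * (f u * g v) *
        (\<Sum>\<chi>\<in>mult_chars. \<Sum>\<psi>\<in>mult_chars. G \<chi> \<psi> * \<chi> (u * x) * \<psi> (v * y))
      = ?e * (f u * g v) *
        (?q ^ 2 * (if v * y = 1 then 0 else char_inv A (1 - u * x - v * y)))"
    \<comment> \<open>\<open>sum_sum_char_binom\<close> needs nonzero arguments; the remaining terms
      are killed by \<open>B 0 = 0\<close> or \<open>B' 0 = 0\<close>.\<close>
    proof (cases "u = 0 \<or> v = 0")
      case True
      then have "f u * g v = 0"
        using mult_chars_zero[OF B] mult_chars_zero[OF B'] by (auto simp: f_def g_def)
      then show ?thesis by simp
    next
      case False
      then show ?thesis
        unfolding G_def using x y by (subst sum_sum_char_binom[OF A]) auto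
    qed
  qed
  also have "\<dots> = ?q ^ 2 * ?e * (\<Sum>u\<in>UNIV. \<Sum>v\<in>UNIV.
      B u * B' v * (char_inv B \<odot> C) (1 - u) * (char_inv B' \<odot> C') (1 - v)
        * (if v * y = 1 then 0 else char_inv A (1 - u * x - v * y)))"
    unfolding f_def g_def sum_distrib_left
    by (intro sum.cong refl) (simp only: mult_ac)
  finally show ?thesis unfolding G_def .
qed

text \<open>At \<open>v = inverse y\<close> the last argument reduces to \<open>- (u * x)\<close>,
  so the variables separate: \<open>v\<close> yields a constant and \<open>u\<close> runs through a
  Jacobi sum.\<close>

lemma appell_boundary_sum:
  fixes A B B' C C' :: "'a::{Fields.field,finite} \<Rightarrow> complex" and x y :: 'a
  assumes A: "A \<in> mult_chars" and B: "B \<in> mult_chars" and B': "B' \<in> mult_chars"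
    and C: "C \<in> mult_chars" and C': "C' \<in> mult_chars"
    and y: "y \<noteq> 0"
  shows "(B \<odot> B' \<odot> C \<odot> C') (-1) *
     (\<Sum>u\<in>UNIV. \<Sum>v\<in>UNIV. B u * B' v * (char_inv B \<odot> C) (1 - u) * (char_inv B' \<odot> C') (1 - v)
        * (if v * y = 1 then char_inv A (1 - u * x - v * y) else 0))
    = char_inv A (-x) * char_inv C' y * (char_inv B' \<odot> C') (1 - y)
      * char_binom (char_inv A \<odot> B) (B \<odot> char_inv C)"
proof -
  let ?K = "B' (inverse y) * (char_inv B' \<odot> C') (1 - inverse y)"
  have vy: "v * y = 1 \<longleftrightarrow> v = inverse y" for v
    using y by (auto simp: field_simps)
  have "(\<Sum>u\<in>UNIV. \<Sum>v\<in>UNIV.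
        B u * B' v * (char_inv B \<odot> C) (1 - u) * (char_inv B' \<odot> C') (1 - v)
        * (if v * y = 1 then char_inv A (1 - u * x - v * y) else 0))
    = (\<Sum>u\<in>UNIV. B u * (char_inv B \<odot> C) (1 - u) * ?K * char_inv A (- (u * x)))"
  proof (rule sum.cong[OF refl])
    fix u :: 'a
    have "(\<Sum>v\<in>UNIV.
        B u * B' v * (char_inv B \<odot> C) (1 - u) * (char_inv B' \<odot> C') (1 - v)
        * (if v * y = 1 then char_inv A (1 - u * x - v * y) else 0))
      = (\<Sum>v\<in>UNIV. if v = inverse y then
        B u * B' v * (char_inv B \<odot> C) (1 - u) * (char_inv B' \<odot> C') (1 - v)
        * char_inv A (1 - u * x - v * y) else 0)"
      by (rule sum.cong) (auto simp: vy)
    then show "(\<Sum>v\<in>UNIV.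
        B u * B' v * (char_inv B \<odot> C) (1 - u) * (char_inv B' \<odot> C') (1 - v)
        * (if v * y = 1 then char_inv A (1 - u * x - v * y) else 0))
      = B u * (char_inv B \<odot> C) (1 - u) * ?K * char_inv A (- (u * x))"
      using y by (simp add: mult_ac)
  qed
  also have "\<dots> = ?K * char_inv A (-x) *
      jacobi_sum (char_inv A \<odot> B) (char_inv (B \<odot> char_inv C))"
  proof -
    have "char_inv A (- (u * x)) = char_inv A u * char_inv A (- x)" for u
      by (simp flip: mult_chars_mult[OF char_inv_in[OF A]])
    then show ?thesis
      by (simp add: jacobi_sum_def char_times_def char_inv_def sum_distrib_left mult_ac)
  qed
  finally have sum_eq: "(\<Sum>u\<in>UNIV. \<Sum>v\<in>UNIV.
        B u * B' v * (char_inv B \<odot> C) (1 - u) * (char_inv B' \<odot> C') (1 - v)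
        * (if v * y = 1 then char_inv A (1 - u * x - v * y) else 0))
    = ?K * char_inv A (-x) * jacobi_sum (char_inv A \<odot> B) (char_inv (B \<odot> char_inv C))" .
  have inv_sign: "inverse (\<chi> (-1)) = \<chi> (-1)" if "\<chi> \<in> mult_chars" for \<chi> :: "'a \<Rightarrow> complex"
    using mult_chars_minus_one_square[OF that] by (simp add: inverse_unique)
  have y_eq: "1 - inverse y = - ((1 - y) / y)"
    using y by (simp add: field_simps)
  have one_minus: "\<chi> (1 - inverse y) = \<chi> (-1) * (\<chi> (1 - y) / \<chi> y)"
    if "\<chi> \<in> mult_chars" for \<chi> :: "'a \<Rightarrow> complex"
    unfolding y_eq mult_chars_minus[OF that, of "(1 - y) / y"] mult_chars_divide[OF that] ..
  \<comment> \<open>\<open>B' (inverse y)\<close> cancels the \<open>B' y\<close> coming from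
    \<open>char_inv B'\<close> at \<open>1 - inverse y\<close>; the analogous factor of
    \<open>C'\<close> survives as \<open>char_inv C' y\<close>, and all signs pair up.\<close>
  have "B' (-1) * C' (-1) * ?K = (B' (-1) * B' (-1)) * (C' (-1) * C' (-1)) *
      (B' y * inverse (B' y)) * (char_inv C' y * (char_inv B' \<odot> C') (1 - y))"
    unfolding char_times_def char_inv_def one_minus[OF B'] one_minus[OF C']
      mult_chars_inverse[OF B'] divide_inverse inverse_mult_distrib inverse_inverse_eq
      inv_sign[OF B']
    by (simp only: mult_ac)
  then have K: "B' (-1) * C' (-1) * ?K = char_inv C' y * (char_inv B' \<odot> C') (1 - y)"
    using mult_chars_nonzero[OF B' y]
    by (simp add: mult_chars_minus_one_square[OF B'] mult_chars_minus_one_square[OF C'])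
  have "(B \<odot> B' \<odot> C \<odot> C') (-1) *
      (?K * char_inv A (-x) * jacobi_sum (char_inv A \<odot> B) (char_inv (B \<odot> char_inv C)))
    = (B' (-1) * C' (-1) * ?K) * char_inv A (-x) * (B (-1) * C (-1) *
        jacobi_sum (char_inv A \<odot> B) (char_inv (B \<odot> char_inv C)))"
    by (simp add: char_times_def[of _ _ "-1"] mult_ac)
  \<comment> \<open>\<open>C (-1)\<close> is its own inverse, so these signs are the value of
    \<open>B \<odot> char_inv C\<close> at -1.\<close>
  also have "B (-1) * C (-1) * jacobi_sum (char_inv A \<odot> B) (char_inv (B \<odot> char_inv C))
      = char_binom (char_inv A \<odot> B) (B \<odot> char_inv C)"
    by (simp add: char_binom_def char_times_def[of _ _ "-1"] char_inv_def[of _ "-1"] inv_sign[OF C])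
  finally show ?thesis
    unfolding sum_eq K by (simp add: mult_ac)
qed

theorem theorem1p3:
  fixes A B B' C C' :: "'a::{field,finite} \<Rightarrow> complex"
    and x y :: 'a
  assumes "A \<in> mult_chars" "B \<in> mult_chars" "B' \<in> mult_chars"
    and "C \<in> mult_chars" "C' \<in> mult_chars"
  shows "appell_F2 A B B' C C' x y =
    1 / (of_nat CARD('a) - 1) ^ 2 *
      (\<Sum>\<chi>\<in>mult_chars. \<Sum>\<psi>\<in>mult_chars.
         char_binom (A \<odot> \<chi>) \<chi> * char_binom (A \<odot> \<chi> \<odot> \<psi>) \<psi>
         * char_binom (B \<odot> \<chi>) (C \<odot> \<chi>) * char_binom (B' \<odot> \<psi>) (C' \<odot> \<psi>)
         * \<chi> x * \<psi> y)
    + char_inv A (-x) * char_inv C' y * (char_inv B' \<odot> C') (1 - y)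
      * char_binom (char_inv A \<odot> B) (B \<odot> char_inv C)"
proof -
  let ?q = "of_nat CARD('a) - 1 :: complex"
  let ?e = "(B \<odot> B' \<odot> C \<odot> C') (-1)"
  let ?t = "\<lambda>u v. B u * B' v * (char_inv B \<odot> C) (1 - u) * (char_inv B' \<odot> C') (1 - v)"
  let ?a = "\<lambda>u v. char_inv A (1 - u * x - v * y)"
  show ?thesis
  proof (cases "x = 0 \<or> y = 0")
    case True
    \<comment> \<open>With \<open>x\<close> or \<open>y\<close> zero, all three parts of the
      identity vanish because every character, the trivial one included, is 0 at 0.\<close>
    have "(\<Sum>\<chi>\<in>mult_chars. \<Sum>\<psi>\<in>mult_chars.
         char_binom (A \<odot> \<chi>) \<chi> * char_binom (A \<odot> \<chi> \<odot> \<psi>) \<psi>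
         * char_binom (B \<odot> \<chi>) (C \<odot> \<chi>) * char_binom (B' \<odot> \<psi>) (C' \<odot> \<psi>)
         * \<chi> x * \<psi> y) = 0"
      using True by (intro sum.neutral ballI) (auto simp: mult_chars_zero)
    moreover have "char_inv A (-x) * char_inv C' y = 0"
      using True assms by (auto simp: char_inv_def mult_chars_zero)
    moreover have "appell_F2 A B B' C C' x y = 0"
      using True by (auto simp: appell_F2_def trivial_char_def)
    ultimately show ?thesis by simp
  next
    case False
    then have x: "x \<noteq> 0" and y: "y \<noteq> 0" by auto
    have "appell_F2 A B B' C C' x y = ?e * (\<Sum>u\<in>UNIV. \<Sum>v\<in>UNIV. ?t u v * ?a u v)"
      using x y by (simp add: appell_F2_def trivial_char_def)
    also have "(\<Sum>u\<in>UNIV. \<Sum>v\<in>UNIV. ?t u v * ?a u v)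
      = (\<Sum>u\<in>UNIV. \<Sum>v\<in>UNIV. ?t u v * (if v * y = 1 then 0 else ?a u v))
        + (\<Sum>u\<in>UNIV. \<Sum>v\<in>UNIV. ?t u v * (if v * y = 1 then ?a u v else 0))"
      unfolding sum.distrib[symmetric] by (intro sum.cong refl) auto
    finally show ?thesis
      unfolding appell_character_sum[OF assms x y]
        appell_boundary_sum[OF assms y, symmetric]
      using of_nat_card_minus_one_nonzero[where 'a = 'a] by (simp add: distrib_left)
  qed
qed

end
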